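(* Let $\mathcal{E}$ be a Hilbert space and let $\mathcal{H}_k\otimes\mathcal{E}$ be a unitarily invariant complete Nevanlinna--Pick space on $\mathbb{B}_n$. Then for any $\Phi\in\mathrm{Mult}_1(\mathcal{H}_k\otimes\mathcal{E})$ the following are equivalent: (i) $M_\Phi$ is a pure contraction on $\mathcal{H}_k\otimes\mathcal{E}$; (ii) $\Phi(0)$ is a pure contraction on $\mathcal{E}$.
   Context: $\mathbb{B}_n$ is the open unit ball of $\mathbb{C}^n$. A unitarily invariant space on $\mathbb{B}_n$ is a reproducing kernel Hilbert space $\mathcal{H}_k$ whose scalar kernel has the form $k(\mathbf{z},\mathbf{w})=\sum_{j=0}^\infty a_j\langle\mathbf{z},\mathbf{w}\rangle^j$ ($\mathbf{z},\mathbf{w}\in\mathbb{B}_n$) with $a_0=1$ and $a_j>0$ for all $j$. $\mathcal{H}_k\otimes\mathcal{E}$ is the $\mathcal{E}$-valued reproducing kernel Hilbert space with kernel $kI_{\mathcal{E}}$; it is called a unitarily invariant complete Nevanlinna--Pick space when $\mathcal{H}_k$ is unitarily invariant and is a complete Nevanlinna--Pick space. $\mathcal{H}_k$ on a set $\Lambda$ is a complete Nevanlinna--Pick space if for all positive integers $l,m$, all points $\lambda_1,\ldots,\lambda_m\in\Lambda$ and all $l\times l$ complex matrices $W_1,\ldots,W_m$, non-negativity of the block matrix $[k(\lambda_i,\lambda_j)(I-W_iW_j^* )]_{i,j=1}^m$ is sufficient for the existence of a multiplier $\Psi$ (of $\mathcal{H}_k\otimes\mathbb{C}^l$) with $\|\Psi\|\le1$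 and $\Psi(\lambda_i)=W_i$ for all $i$. A multiplier of $\mathcal{H}_k\otimes\mathcal{E}$ is a function $\Phi:\mathbb{B}_n\to\mathcal{B}(\mathcal{E})$ with $\Phi f\in\mathcal{H}_k\otimes\mathcal{E}$ for all $f\in\mathcal{H}_k\otimes\mathcal{E}$; $M_\Phi$ is the (bounded) operator $f\mapsto\Phi f$, its norm is taken as $\|\Phi\|=\|M_\Phi\|$, and $\mathrm{Mult}_1$ is the set of multipliers of norm at most $1$. A contraction $T$ on a Hilbert space $\mathcal{H}$ is pure if $\|T^{*l}h\|\to0$ as $l\to\infty$ for every $h\in\mathcal{H}$. *)

theory Defs
  imports "HOL-Analysis.Analysis" "HOL-Library.Function_Algebras"
begin

section \<open>Complex Hilbert spaces with explicit carrier\<close>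

text \<open>
  A Hilbert space is a complete inner product structure on a linear subspace of an ambient
  complex vector space.  The carrier is explicit because the spaces \<open>\<complex>\<^sup>l\<close> with varying \<open>l\<close>, and
  spaces of functions into them, occur inside one definition (that of the complete
  Nevanlinna--Pick property).  Addition is that of the ambient type; on functions it is pointwise.
  Inner products are linear in the first argument and conjugate linear in the second.
\<close>

record 'a hspace =
  hcarrier :: "'a set"
  hscale :: "complex \<Rightarrow> 'a \<Rightarrow> 'a"
  hinner :: "'a \<Rightarrow> 'a \<Rightarrow> complex"

definition hnorm :: "'a hspace \<Rightarrow> 'a \<Rightarrow> real" where
  "hnorm H x = sqrt (Re (hinner H x x))"

locale complex_hilbert_space = vector_space "hscale H"
  for H :: "'a::ab_group_add hspace" +
  assumes subspace_carrier: "subspace (hcarrier H)"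
    and inner_add_left:
      "\<lbrakk>x \<in> hcarrier H; y \<in> hcarrier H; z \<in> hcarrier H\<rbrakk>
        \<Longrightarrow> hinner H (x + y) z = hinner H x z + hinner H y z"
    and inner_scale_left:
      "\<lbrakk>x \<in> hcarrier H; y \<in> hcarrier H\<rbrakk> \<Longrightarrow> hinner H (hscale H c x) y = c * hinner H x y"
    and inner_commute:
      "\<lbrakk>x \<in> hcarrier H; y \<in> hcarrier H\<rbrakk> \<Longrightarrow> hinner H x y = cnj (hinner H y x)"
    and inner_nonneg: "x \<in> hcarrier H \<Longrightarrow> 0 \<le> Re (hinner H x x)"
    and inner_definite: "\<lbrakk>x \<in> hcarrier H; hinner H x x = 0\<rbrakk> \<Longrightarrow> x = 0"
    and complete:
      "\<lbrakk>\<And>n. X n \<in> hcarrier H;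
        \<And>e. e > 0 \<Longrightarrow> \<exists>N::nat. \<forall>m\<ge>N. \<forall>n\<ge>N. hnorm H (X m - X n) < e\<rbrakk>
        \<Longrightarrow> \<exists>L\<in>hcarrier H. (\<lambda>n. hnorm H (X n - L)) \<longlonglongrightarrow> 0"

definition cvec_space :: "nat \<Rightarrow> (nat \<Rightarrow> complex) hspace" where
  "cvec_space l =
    \<lparr> hcarrier = {v. \<forall>i\<ge>l. v i = 0},
      hscale = (\<lambda>c v i. c * v i),
      hinner = (\<lambda>u v. \<Sum>i<l. u i * cnj (v i)) \<rparr>"


section \<open>Operators\<close>

text \<open>Operators are HOL functions of which only the values on the carrier matter.\<close>

definition bounded_op :: "'a::ab_group_add hspace \<Rightarrow> ('a \<Rightarrow> 'a) \<Rightarrow> bool" where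
  "bounded_op H T \<longleftrightarrow>
    (\<forall>x\<in>hcarrier H. T x \<in> hcarrier H) \<and>
    (\<forall>x\<in>hcarrier H. \<forall>y\<in>hcarrier H. T (x + y) = T x + T y) \<and>
    (\<forall>c. \<forall>x\<in>hcarrier H. T (hscale H c x) = hscale H c (T x)) \<and>
    (\<exists>C. \<forall>x\<in>hcarrier H. hnorm H (T x) \<le> C * hnorm H x)"

text \<open>As in \<^const>\<open>onorm\<close>, the quotient at \<open>x = 0\<close> is \<open>0 / 0 = 0\<close>.\<close>

definition op_norm :: "'a hspace \<Rightarrow> ('a \<Rightarrow> 'a) \<Rightarrow> real" where
  "op_norm H T = (SUP x\<in>hcarrier H. hnorm H (T x) / hnorm H x)"

definition contraction :: "'a::ab_group_add hspace \<Rightarrow> ('a \<Rightarrow> 'a) \<Rightarrow> bool" where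
  "contraction H T \<longleftrightarrow> bounded_op H T \<and> op_norm H T \<le> 1"

definition adjoint_op :: "'a hspace \<Rightarrow> ('a \<Rightarrow> 'a) \<Rightarrow> 'a \<Rightarrow> 'a" where
  "adjoint_op H T y =
    (THE x. x \<in> hcarrier H \<and> (\<forall>z\<in>hcarrier H. hinner H (T z) y = hinner H z x))"

definition pure_contraction :: "'a::ab_group_add hspace \<Rightarrow> ('a \<Rightarrow> 'a) \<Rightarrow> bool" where
  "pure_contraction H T \<longleftrightarrow>
    contraction H T \<and>
    (\<forall>h\<in>hcarrier H. (\<lambda>l. hnorm H ((adjoint_op H T ^^ l) h)) \<longlonglongrightarrow> 0)"


section \<open>Vector-valued reproducing kernel Hilbert spaces and multipliers\<close>

text \<open>
  \<open>is_rkhs \<Lambda> E K H\<close>: \<open>H\<close> is the \<open>E\<close>-valued reproducing kernel Hilbert space on \<open>\<Lambda>\<close> with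
  operator-valued kernel \<open>K\<close>.  Functions on \<open>\<Lambda>\<close> are represented by their extension by \<open>0\<close>.
  The carrier of \<open>H\<close> and the inner product on it are determined by \<open>E\<close>, \<open>\<Lambda>\<close> and \<open>K\<close>.
\<close>

definition is_rkhs ::
  "'x set \<Rightarrow> 'e::ab_group_add hspace \<Rightarrow> ('x \<Rightarrow> 'x \<Rightarrow> 'e \<Rightarrow> 'e) \<Rightarrow> ('x \<Rightarrow> 'e) hspace \<Rightarrow> bool" where
  "is_rkhs \<Lambda> E K H \<longleftrightarrow>
    complex_hilbert_space H \<and>
    hscale H = (\<lambda>c f z. hscale E c (f z)) \<and>
    (\<forall>f\<in>hcarrier H. (\<forall>z\<in>\<Lambda>. f z \<in> hcarrier E) \<and> (\<forall>z. z \<notin> \<Lambda> \<longrightarrow> f z = 0)) \<and>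
    (\<forall>w\<in>\<Lambda>. \<forall>e\<in>hcarrier E.
      (\<lambda>z. if z \<in> \<Lambda> then K z w e else 0) \<in> hcarrier H \<and>
      (\<forall>f\<in>hcarrier H. hinner H f (\<lambda>z. if z \<in> \<Lambda> then K z w e else 0) = hinner E (f w) e))"

text \<open>The kernel \<open>k I\<^sub>E\<close>, so that \<open>is_rkhs \<Lambda> E (scalar_kernel E k) H\<close> says that \<open>H\<close> is \<open>H\<^sub>k \<otimes> E\<close>.\<close>

definition scalar_kernel ::
  "'e hspace \<Rightarrow> ('x \<Rightarrow> 'x \<Rightarrow> complex) \<Rightarrow> 'x \<Rightarrow> 'x \<Rightarrow> 'e \<Rightarrow> 'e" where
  "scalar_kernel E k z w e = hscale E (k z w) e"

definition mult_op :: "'x set \<Rightarrow> ('x \<Rightarrow> 'e \<Rightarrow> 'e) \<Rightarrow> ('x \<Rightarrow> 'e::zero) \<Rightarrow> 'x \<Rightarrow> 'e" where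
  "mult_op \<Lambda> \<Phi> f = (\<lambda>z. if z \<in> \<Lambda> then \<Phi> z (f z) else 0)"

definition multiplier ::
  "'x set \<Rightarrow> 'e::ab_group_add hspace \<Rightarrow> ('x \<Rightarrow> 'e) hspace \<Rightarrow> ('x \<Rightarrow> 'e \<Rightarrow> 'e) \<Rightarrow> bool" where
  "multiplier \<Lambda> E H \<Phi> \<longleftrightarrow>
    (\<forall>z\<in>\<Lambda>. bounded_op E (\<Phi> z)) \<and>
    (\<forall>f\<in>hcarrier H. mult_op \<Lambda> \<Phi> f \<in> hcarrier H)"

definition Mult1 ::
  "'x set \<Rightarrow> 'e::ab_group_add hspace \<Rightarrow> ('x \<Rightarrow> 'e) hspace \<Rightarrow> ('x \<Rightarrow> 'e \<Rightarrow> 'e) set" where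
  "Mult1 \<Lambda> E H =
    {\<Phi>. multiplier \<Lambda> E H \<Phi> \<and> bounded_op H (mult_op \<Lambda> \<Phi>) \<and> op_norm H (mult_op \<Lambda> \<Phi>) \<le> 1}"


section \<open>Complete Nevanlinna--Pick spaces\<close>

text \<open>
  An \<open>l \<times> l\<close> matrix is a function of two indices below \<open>l\<close>; entries outside this range are ignored.
\<close>

definition matrix_op :: "nat \<Rightarrow> (nat \<Rightarrow> nat \<Rightarrow> complex) \<Rightarrow> (nat \<Rightarrow> complex) \<Rightarrow> nat \<Rightarrow> complex" where
  "matrix_op l A v = (\<lambda>p. if p < l then \<Sum>q<l. A p q * v q else 0)"

text \<open>Entry \<open>(p, q)\<close> of the \<open>l \<times> l\<close> block \<open>k(\<lambda>\<^sub>i, \<lambda>\<^sub>j) (I - W\<^sub>i W\<^sub>j\<^sup>*)\<close>.\<close>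

definition pick_entry ::
  "nat \<Rightarrow> ('x \<Rightarrow> 'x \<Rightarrow> complex) \<Rightarrow> (nat \<Rightarrow> 'x) \<Rightarrow> (nat \<Rightarrow> nat \<Rightarrow> nat \<Rightarrow> complex)
    \<Rightarrow> nat \<Rightarrow> nat \<Rightarrow> nat \<Rightarrow> nat \<Rightarrow> complex" where
  "pick_entry l k x W i j p q =
    k (x i) (x j) * ((if p = q then 1 else 0) - (\<Sum>r<l. W i p r * cnj (W j q r)))"

definition nonneg_block_matrix ::
  "nat \<Rightarrow> nat \<Rightarrow> (nat \<Rightarrow> nat \<Rightarrow> nat \<Rightarrow> nat \<Rightarrow> complex) \<Rightarrow> bool" where
  "nonneg_block_matrix m l A \<longleftrightarrow>
    (\<forall>v :: nat \<Rightarrow> nat \<Rightarrow> complex.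
      (\<Sum>i<m. \<Sum>j<m. \<Sum>p<l. \<Sum>q<l. cnj (v i p) * A i j p q * v j q) \<in> \<real>\<^sub>\<ge>\<^sub>0)"

text \<open>The quantified \<open>H\<close> is \<open>H\<^sub>k \<otimes> \<complex>\<^sup>l\<close>.\<close>

definition complete_nevanlinna_pick :: "'x set \<Rightarrow> ('x \<Rightarrow> 'x \<Rightarrow> complex) \<Rightarrow> bool" where
  "complete_nevanlinna_pick \<Lambda> k \<longleftrightarrow>
    (\<forall>l>0. \<forall>m>0. \<forall>x W H.
      (\<forall>i<m. x i \<in> \<Lambda>) \<longrightarrow>
      nonneg_block_matrix m l (pick_entry l k x W) \<longrightarrow>
      is_rkhs \<Lambda> (cvec_space l) (scalar_kernel (cvec_space l) k) H \<longrightarrow>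
      (\<exists>\<Psi> \<in> Mult1 \<Lambda> (cvec_space l) H.
        \<forall>i<m. \<forall>v\<in>hcarrier (cvec_space l). \<Psi> (x i) v = matrix_op l (W i) v))"


section \<open>Unitarily invariant spaces on the unit ball\<close>

definition cinner :: "complex^'n \<Rightarrow> complex^'n \<Rightarrow> complex" where
  "cinner z w = (\<Sum>i\<in>UNIV. z $ i * cnj (w $ i))"

definition unitarily_invariant_kernel :: "(complex^'n \<Rightarrow> complex^'n \<Rightarrow> complex) \<Rightarrow> bool" where
  "unitarily_invariant_kernel k \<longleftrightarrow>
    (\<exists>a :: nat \<Rightarrow> real. a 0 = 1 \<and> (\<forall>j. a j > 0) \<and>
      (\<forall>z\<in>ball 0 1. \<forall>w\<in>ball 0 1. (\<lambda>j. of_real (a j) * cinner z w ^ j) sums k z w))"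

definition unitarily_invariant_CNP_space ::
  "'e::ab_group_add hspace \<Rightarrow> (complex^'n \<Rightarrow> complex^'n \<Rightarrow> complex)
    \<Rightarrow> (complex^'n \<Rightarrow> 'e) hspace \<Rightarrow> bool" where
  "unitarily_invariant_CNP_space E k H \<longleftrightarrow>
    is_rkhs (ball 0 1) E (scalar_kernel E k) H \<and>
    unitarily_invariant_kernel k \<and>
    complete_nevanlinna_pick (ball 0 1) k"

end

theory Submission
  imports Defs
begin

text \<open>
  Write \<open>T\<close> for the adjoint of \<open>M\<^sub>\<Phi>\<close> and \<open>k\<^sub>w e\<close> for the kernel functions, so that
  \<open>T (k\<^sub>w e) = k\<^sub>w (\<Phi>(w)\<^sup>* e)\<close>.  Since \<open>k\<^sub>0 = 1\<close>, purity of \<open>M\<^sub>\<Phi>\<close> restricts to purity of \<open>\<Phi>(0)\<close>.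
  Conversely, \<open>\<langle>f, g\<rangle> - \<langle>T\<^sup>n f, T\<^sup>n g\<rangle>\<close> is a positive semidefinite form; if \<open>T\<^sup>n f \<longlonglongrightarrow> 0\<close>, its
  Cauchy--Schwarz inequality gives \<open>|\<langle>f, g\<rangle>|\<^sup>2 \<le> \<parallel>f\<parallel>\<^sup>2 (\<parallel>g\<parallel>\<^sup>2 - lim \<parallel>T\<^sup>n g\<parallel>\<^sup>2)\<close>.  With
  \<open>y\<^sub>l = \<Phi>(w)\<^sup>*\<^sup>l y\<close>, \<open>f = k\<^sub>0 y\<^sub>l\<close>, \<open>g = k\<^sub>w y\<^sub>l\<close> and \<open>L = lim \<parallel>y\<^sub>l\<parallel>\<close> this reads
  \<open>\<parallel>y\<^sub>l\<parallel>\<^sup>4 \<le> \<parallel>y\<^sub>l\<parallel>\<^sup>2 k(w, w) (\<parallel>y\<^sub>l\<parallel>\<^sup>2 - L\<^sup>2)\<close>, and \<open>l \<longlonglongrightarrow> \<infinity>\<close> forces \<open>L = 0\<close>.  Thus \<open>T\<^sup>n \<longlonglongrightarrow> 0\<close> strongly on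
  the kernel functions, hence on their closed linear span, which is the whole space.
\<close>

section \<open>Geometry of Hilbert spaces\<close>

text \<open>Discriminant argument along \<open>c = t * d\<close> with \<open>t\<close> real. Stated
  for bare numbers so that it serves Cauchy-Schwarz for the inner product and for the defect form,
  and, with \<open>a = 0\<close>, the orthogonality of a nearest-point residual.\<close>

lemma complex_quadratic_nonneg_imp:
  fixes a b :: real and d :: complex
  assumes nonneg: "\<And>c. 0 \<le> a - 2 * Re (cnj c * d) + (cmod c)\<^sup>2 * b" and "0 \<le> b"
  shows "(cmod d)\<^sup>2 \<le> a * b"
proof -
  have real_param: "0 \<le> a - 2 * t * (cmod d)\<^sup>2 + t\<^sup>2 * (cmod d)\<^sup>2 * b" for t :: real
  proof -
    have "Re (cnj (of_real t * d) * d) = t * (cmod d)\<^sup>2"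
      unfolding cmod_power2 by (simp add: power2_eq_square algebra_simps)
    then show ?thesis
      using nonneg[of "of_real t * d"] by (simp add: norm_mult power_mult_distrib)
  qed
  show ?thesis
  proof (cases "b = 0")
    case True
    have "d = 0"
    proof (rule ccontr)
      assume "d \<noteq> 0"
      \<comment> \<open>For \<open>b = 0\<close> the expression is affine in \<open>t\<close>, and
        this \<open>t\<close> gives it the value \<open>-1\<close>.\<close>
      then show False
        using real_param[of "(a + 1) / (2 * (cmod d)\<^sup>2)"] True by (simp add: field_simps)
    qed
    then show ?thesis using True by simp
  next
    case False
    then have "b > 0" using \<open>0 \<le> b\<close> by simp
    \<comment> \<open>The quadratic in \<open>t\<close> is smallest at
      \<open>t = 1 / b\<close>.\<close>
    then show ?thesis
      using real_param[of "1 / b"] by (simp add: field_simps power2_eq_square)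
  qed
qed

context complex_hilbert_space
begin

lemma carrier_zero [simp]: "0 \<in> hcarrier H"
  and carrier_add [simp]: "\<lbrakk>x \<in> hcarrier H; y \<in> hcarrier H\<rbrakk> \<Longrightarrow> x + y \<in> hcarrier H"
  and carrier_scale [simp]: "x \<in> hcarrier H \<Longrightarrow> hscale H c x \<in> hcarrier H"
  and carrier_diff [simp]: "\<lbrakk>x \<in> hcarrier H; y \<in> hcarrier H\<rbrakk> \<Longrightarrow> x - y \<in> hcarrier H"
  using subspace_carrier by (auto intro: subspace_0 subspace_add subspace_scale subspace_diff)

lemma inner_diff_left:
  assumes "x \<in> hcarrier H" "y \<in> hcarrier H" "z \<in> hcarrier H"
  shows "hinner H (x - y) z = hinner H x z - hinner H y z"
  using inner_add_left[of "x - y" y z] assms by simp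

lemma inner_add_right:
  assumes "x \<in> hcarrier H" "y \<in> hcarrier H" "z \<in> hcarrier H"
  shows "hinner H x (y + z) = hinner H x y + hinner H x z"
  using assms inner_commute[of x "y + z"] inner_commute[of x y] inner_commute[of x z]
  by (simp add: inner_add_left)

lemma inner_diff_right:
  assumes "x \<in> hcarrier H" "y \<in> hcarrier H" "z \<in> hcarrier H"
  shows "hinner H x (y - z) = hinner H x y - hinner H x z"
  using inner_add_right[of x "y - z" z] assms by simp

lemma inner_scale_right:
  assumes "x \<in> hcarrier H" "y \<in> hcarrier H"
  shows "hinner H x (hscale H c y) = cnj c * hinner H x y"
  using assms inner_commute[of x "hscale H c y"] inner_commute[of x y]
  by (simp add: inner_scale_left)

lemma inner_zero_left [simp]: "x \<in> hcarrier H \<Longrightarrow> hinner H 0 x = 0"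
  using inner_diff_left[of 0 0 x] by simp

lemma inner_zero_right [simp]: "x \<in> hcarrier H \<Longrightarrow> hinner H x 0 = 0"
  using inner_diff_right[of x 0 0] by simp

lemma hnorm_nonneg [simp]: "x \<in> hcarrier H \<Longrightarrow> 0 \<le> hnorm H x"
  by (simp add: hnorm_def inner_nonneg)

lemma power2_hnorm: "x \<in> hcarrier H \<Longrightarrow> (hnorm H x)\<^sup>2 = Re (hinner H x x)"
  by (simp add: hnorm_def inner_nonneg)

lemma inner_self: "x \<in> hcarrier H \<Longrightarrow> hinner H x x = of_real ((hnorm H x)\<^sup>2)"
  using inner_commute[of x x] by (simp add: power2_hnorm complex_eq_iff)

lemma hnorm_eq_0 [simp]: "x \<in> hcarrier H \<Longrightarrow> hnorm H x = 0 \<longleftrightarrow> x = 0"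
  using inner_self[of x] inner_definite[of x] inner_zero_left[of x] by auto

lemma hnorm_zero [simp]: "hnorm H 0 = 0"
  by simp

text \<open>The right side has the shape required by \<open>complex_quadratic_nonneg_imp\<close>.
  The values \<open>c = 1\<close> and \<open>c = -1\<close> lead to the parallelogram and triangle
  laws, and \<open>x = 0\<close> to the norm of a scalar multiple.\<close>

lemma power2_hnorm_diff_scale:
  assumes "x \<in> hcarrier H" "y \<in> hcarrier H"
  shows "(hnorm H (x - hscale H c y))\<^sup>2 =
    (hnorm H x)\<^sup>2 - 2 * Re (cnj c * hinner H x y) + (cmod c)\<^sup>2 * (hnorm H y)\<^sup>2"
proof -
  have "hinner H y x = cnj (hinner H x y)"
    by (rule inner_commute[OF assms(2,1)])
  moreover have "c * cnj c = (of_real (cmod c))\<^sup>2"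
    using complex_norm_square[of c] by simp
  ultimately have "hinner H (x - hscale H c y) (x - hscale H c y) =
      (hnorm H x)\<^sup>2 - (cnj c * hinner H x y + cnj (cnj c * hinner H x y)) + (cmod c)\<^sup>2 * (hnorm H y)\<^sup>2"
    using assms
    by (simp add: inner_diff_left inner_diff_right inner_scale_left inner_scale_right
        inner_self[OF assms(1)] inner_self[OF assms(2)] algebra_simps)
  then show ?thesis
    using assms by (simp add: power2_hnorm del: of_real_power of_real_mult)
qed

lemma hnorm_scale: "x \<in> hcarrier H \<Longrightarrow> hnorm H (hscale H c x) = cmod c * hnorm H x"
  using power2_hnorm_diff_scale[of 0 x "- c"]
  by - (rule power2_eq_imp_eq, auto simp: power_mult_distrib)

lemma cauchy_schwarz:
  assumes "x \<in> hcarrier H" "y \<in> hcarrier H"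
  shows "cmod (hinner H x y) \<le> hnorm H x * hnorm H y"
proof -
  have "(cmod (hinner H x y))\<^sup>2 \<le> (hnorm H x)\<^sup>2 * (hnorm H y)\<^sup>2"
    by (rule complex_quadratic_nonneg_imp)
      (simp_all only: power2_hnorm_diff_scale[OF assms, symmetric] zero_le_power2)
  then show ?thesis
    using assms by - (rule power2_le_imp_le, auto simp: power_mult_distrib)
qed

lemma hnorm_triangle:
  assumes "x \<in> hcarrier H" "y \<in> hcarrier H"
  shows "hnorm H (x + y) \<le> hnorm H x + hnorm H y"
proof -
  have "(hnorm H (x + y))\<^sup>2 = (hnorm H x)\<^sup>2 + 2 * Re (hinner H x y) + (hnorm H y)\<^sup>2"
    using power2_hnorm_diff_scale[OF assms, of "- 1"] by simp
  also have "\<dots> \<le> (hnorm H x + hnorm H y)\<^sup>2"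
    using cauchy_schwarz[OF assms] complex_Re_le_cmod[of "hinner H x y"]
    by (simp add: power2_sum)
  finally show ?thesis
    using assms by - (rule power2_le_imp_le, auto)
qed

lemma hnorm_minus_commute:
  assumes "x \<in> hcarrier H" "y \<in> hcarrier H"
  shows "hnorm H (x - y) = hnorm H (y - x)"
  using hnorm_scale[of "x - y" "- 1"] assms by simp

lemma parallelogram:
  assumes "x \<in> hcarrier H" "y \<in> hcarrier H"
  shows "(hnorm H (x - y))\<^sup>2 + (hnorm H (x + y))\<^sup>2 = 2 * (hnorm H x)\<^sup>2 + 2 * (hnorm H y)\<^sup>2"
  using power2_hnorm_diff_scale[OF assms, of 1] power2_hnorm_diff_scale[OF assms, of "- 1"] by simp

section \<open>Orthogonal projection and the Riesz representation theorem\<close>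

text \<open>A minimising sequence is Cauchy by the parallelogram law, and completeness supplies the
  nearest point. Closedness is phrased by sequences in \<open>hnorm\<close>, as the ambient type
  carries no topology.\<close>

lemma orthogonal_projection:
  assumes S: "subspace S" "S \<subseteq> hcarrier H"
    and closed: "\<And>X L. \<lbrakk>\<And>n. X n \<in> S; L \<in> hcarrier H; (\<lambda>n. hnorm H (X n - L)) \<longlonglongrightarrow> 0\<rbrakk> \<Longrightarrow> L \<in> S"
    and x: "x \<in> hcarrier H"
  obtains p where "p \<in> S" "\<And>s. s \<in> S \<Longrightarrow> hinner H (x - p) s = 0"
proof -
  define d where "d = (INF s\<in>S. (hnorm H (x - s))\<^sup>2)"
  have bdd: "bdd_below ((\<lambda>s. (hnorm H (x - s))\<^sup>2) ` S)"
    by (rule bdd_belowI[of _ 0]) auto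
  have d_le: "d \<le> (hnorm H (x - s))\<^sup>2" if "s \<in> S" for s
    unfolding d_def using bdd that by (rule cINF_lower)
  have "\<exists>s\<in>S. (hnorm H (x - s))\<^sup>2 < d + 1 / Suc n" for n
    using cINF_less_iff[OF _ bdd, of "d + 1 / Suc n"] subspace_0[OF S(1)]
    unfolding d_def[symmetric] by force
  then obtain X where X: "\<And>n. X n \<in> S" "\<And>n. (hnorm H (x - X n))\<^sup>2 < d + 1 / Suc n"
    by metis
  have XH: "X n \<in> hcarrier H" for n using X(1) S(2) by auto
  have cauchy: "(hnorm H (X m - X n))\<^sup>2 \<le> 2 / Suc m + 2 / Suc n" for m n
  proof -
    \<comment> \<open>The midpoint lies in \<open>S\<close>, so its squared distance to
      \<open>x\<close> is at least \<open>d\<close>; the parallelogram law turns this into a bound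
      on \<open>X m - X n\<close>.\<close>
    define s where "s = hscale H (1/2) (X m + X n)"
    have "s \<in> S" unfolding s_def using X(1) S(1) by (intro subspace_scale subspace_add)
    have "hscale H 2 (x - s) = (x - X n) + (x - X m)"
      unfolding s_def scale_right_diff_distrib scale_scale
      using scale_left_distrib[of 1 1 x] by simp
    then have "(hnorm H ((x - X n) + (x - X m)))\<^sup>2 = 4 * (hnorm H (x - s))\<^sup>2"
      using hnorm_scale[of "x - s" 2] x S(2) \<open>s \<in> S\<close> by (auto simp: power_mult_distrib)
    moreover have "(x - X n) - (x - X m) = X m - X n" by simp
    ultimately show ?thesis
      using parallelogram[of "x - X n" "x - X m"] x XH d_le[OF \<open>s \<in> S\<close>] X(2)[of m] X(2)[of n]
      by simp
  qed
  obtain p where p: "p \<in> hcarrier H" "(\<lambda>n. hnorm H (X n - p)) \<longlonglongrightarrow> 0"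
  proof -
    have "\<exists>N. \<forall>m\<ge>N. \<forall>n\<ge>N. hnorm H (X m - X n) < e" if "e > 0" for e
    proof -
      obtain N where N: "4 / e\<^sup>2 < real N" using reals_Archimedean2 by blast
      have "hnorm H (X m - X n) < e" if "m \<ge> N" "n \<ge> N" for m n
      proof -
        have "N > 0" using N \<open>e > 0\<close> by (auto intro: gr0I simp: field_simps)
        have "2 / Suc m + 2 / Suc n \<le> 2 / real N + 2 / real N"
          using that \<open>N > 0\<close> by (intro add_mono divide_left_mono) auto
        also have "\<dots> < e\<^sup>2"
          using N \<open>e > 0\<close> \<open>N > 0\<close> by (simp add: field_simps)
        finally have "(hnorm H (X m - X n))\<^sup>2 < e\<^sup>2" using cauchy[of m n] by simp
        then show ?thesis using \<open>e > 0\<close> by (simp add: power_less_imp_less_base)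
      qed
      then show ?thesis by blast
    qed
    then show ?thesis using complete[of X] XH that by blast
  qed
  have "p \<in> S" using closed[OF X(1) p] .
  have min: "(hnorm H (x - p))\<^sup>2 \<le> d"
  proof (rule LIMSEQ_le)
    show "(\<lambda>n. d + 1 / Suc n) \<longlonglongrightarrow> d"
      using tendsto_add[OF tendsto_const[of d] LIMSEQ_inverse_real_of_nat]
      by (simp add: inverse_eq_divide)
    \<comment> \<open>By the triangle inequality the difference bounds the distance from
      \<open>x\<close> to \<open>X n\<close> from below; truncation at \<open>0\<close> lets
      squaring preserve the inequality.\<close>
    show "(\<lambda>n. (max 0 (hnorm H (x - p) - hnorm H (X n - p)))\<^sup>2) \<longlonglongrightarrow> (hnorm H (x - p))\<^sup>2"
    proof -
      have "(\<lambda>n. (max 0 (hnorm H (x - p) - hnorm H (X n - p)))\<^sup>2)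
          \<longlonglongrightarrow> (max 0 (hnorm H (x - p) - 0))\<^sup>2"
        by (intro tendsto_intros p)
      then show ?thesis using x p by simp
    qed
    show "\<exists>N. \<forall>n\<ge>N. (max 0 (hnorm H (x - p) - hnorm H (X n - p)))\<^sup>2 \<le> d + 1 / Suc n"
    proof (intro exI allI impI)
      fix n
      have "max 0 (hnorm H (x - p) - hnorm H (X n - p)) \<le> hnorm H (x - X n)"
        using hnorm_triangle[of "x - X n" "X n - p"] x XH p by simp
      then have "(max 0 (hnorm H (x - p) - hnorm H (X n - p)))\<^sup>2 \<le> (hnorm H (x - X n))\<^sup>2"
        by (intro power_mono) auto
      then show "(max 0 (hnorm H (x - p) - hnorm H (X n - p)))\<^sup>2 \<le> d + 1 / Suc n"
        using X(2)[of n] by simp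
    qed
  qed
  have "hinner H (x - p) s = 0" if "s \<in> S" for s
  proof -
    have sH: "s \<in> hcarrier H" using that S(2) by auto
    \<comment> \<open>Moving \<open>p\<close> to \<open>p + hscale H c s\<close> stays in
      \<open>S\<close> and cannot shorten the distance, so the quadratic in \<open>c\<close> has
      constant term \<open>0\<close>.\<close>
    have "0 \<le> 0 - 2 * Re (cnj c * hinner H (x - p) s) + (cmod c)\<^sup>2 * (hnorm H s)\<^sup>2" for c
    proof -
      have "p + hscale H c s \<in> S"
        using that \<open>p \<in> S\<close> S(1) by (intro subspace_add subspace_scale)
      then have "(hnorm H (x - p))\<^sup>2 \<le> (hnorm H (x - p - hscale H c s))\<^sup>2"
        using min d_le by (metis diff_diff_add order_trans)
      then show ?thesis
        using power2_hnorm_diff_scale[of "x - p" s c] x p sH by simp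
    qed
    then have "(cmod (hinner H (x - p) s))\<^sup>2 \<le> 0 * (hnorm H s)\<^sup>2"
      by (rule complex_quadratic_nonneg_imp) auto
    then show ?thesis by simp
  qed
  with \<open>p \<in> S\<close> show ?thesis by (rule that)
qed

text \<open>The kernel \<open>N\<close> of a nonzero \<open>\<phi>\<close> is closed by boundedness.
  The residual \<open>u\<close> of a vector outside \<open>N\<close> is orthogonal to
  \<open>N\<close>, and modulo \<open>N\<close> every vector is a multiple of \<open>u\<close>, so a
  multiple of \<open>u\<close> represents \<open>\<phi>\<close>.\<close>

lemma riesz_representation:
  assumes add: "\<And>x y. \<lbrakk>x \<in> hcarrier H; y \<in> hcarrier H\<rbrakk> \<Longrightarrow> \<phi> (x + y) = \<phi> x + \<phi> y"
    and scale: "\<And>c x. x \<in> hcarrier H \<Longrightarrow> \<phi> (hscale H c x) = c * \<phi> x"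
    and bound: "\<And>x. x \<in> hcarrier H \<Longrightarrow> cmod (\<phi> x) \<le> C * hnorm H x"
  obtains y where "y \<in> hcarrier H" "\<And>x. x \<in> hcarrier H \<Longrightarrow> \<phi> x = hinner H x y"
proof (cases "\<forall>x\<in>hcarrier H. \<phi> x = 0")
  case True
  then show ?thesis using that[of 0] by simp
next
  case False
  then obtain x0 where x0: "x0 \<in> hcarrier H" "\<phi> x0 \<noteq> 0" by blast
  have diff: "\<phi> (x - y) = \<phi> x - \<phi> y" if "x \<in> hcarrier H" "y \<in> hcarrier H" for x y
    using add[of "x - y" y] that by simp
  define N where "N = {x \<in> hcarrier H. \<phi> x = 0}"
  have "subspace N"
    using scale[of 0 0] by (auto simp: N_def subspace_def add scale)
  moreover have "L \<in> N"
    if X: "\<And>n. X n \<in> N" and L: "L \<in> hcarrier H" "(\<lambda>n. hnorm H (X n - L)) \<longlonglongrightarrow> 0" for X L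
  proof -
    have "cmod (\<phi> L) \<le> C * hnorm H (X n - L)" for n
      using bound[of "X n - L"] diff[of "X n" L] X[of n] L by (simp add: N_def)
    moreover have "(\<lambda>n. C * hnorm H (X n - L)) \<longlonglongrightarrow> 0"
      using tendsto_mult_right_zero[OF L(2)] .
    ultimately have "cmod (\<phi> L) \<le> 0"
      by (meson LIMSEQ_le_const)
    then show ?thesis using L by (simp add: N_def)
  qed
  ultimately obtain p where p: "p \<in> N" "\<And>s. s \<in> N \<Longrightarrow> hinner H (x0 - p) s = 0"
    using orthogonal_projection[of N x0] x0 by (auto simp: N_def)
  define u where "u = x0 - p"
  have u: "u \<in> hcarrier H" "\<phi> u \<noteq> 0"
    using x0 p(1) by (auto simp: u_def N_def diff)
  have "u \<noteq> 0" using u scale[of 0 0] by auto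
  then have uu: "hinner H u u \<noteq> 0" using inner_definite u by blast
  show ?thesis
  proof (rule that)
    \<comment> \<open>The scalar is forced by evaluating \<open>\<phi>\<close> at \<open>u\<close>;
      it is conjugated because it sits in the second argument.\<close>
    show "hscale H (cnj (\<phi> u / hinner H u u)) u \<in> hcarrier H" using u by simp
    fix x assume x: "x \<in> hcarrier H"
    define s where "s = x - hscale H (\<phi> x / \<phi> u) u"
    have "s \<in> N" using x u by (simp add: s_def N_def diff scale)
    then have "hinner H s u = 0"
      using p(2)[of s] inner_commute[of s u] u by (simp add: u_def[symmetric] N_def)
    then have "hinner H x u = \<phi> x / \<phi> u * hinner H u u"
      using x u by (simp add: s_def inner_diff_left inner_scale_left)
    then show "\<phi> x = hinner H x (hscale H (cnj (\<phi> u / hinner H u u)) u)"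
      using x u uu by (simp add: inner_scale_right)
  qed
qed


section \<open>Contractions and adjoints\<close>

lemma inner_right_eqI:
  assumes "x \<in> hcarrier H" "y \<in> hcarrier H"
    and "\<And>z. z \<in> hcarrier H \<Longrightarrow> hinner H z x = hinner H z y"
  shows "x = y"
  using inner_definite[of "x - y"] assms by (simp add: inner_diff_right)

text \<open>Nondegeneracy makes the \<open>THE\<close> unique, so adjoints can be computed by
  checking the defining relation.\<close>

lemma adjoint_op_eqI:
  assumes "x \<in> hcarrier H" "\<And>z. z \<in> hcarrier H \<Longrightarrow> hinner H (T z) y = hinner H z x"
  shows "adjoint_op H T y = x"
  unfolding adjoint_op_def using assms by (intro the_equality) (auto intro: inner_right_eqI)

text \<open>The functional \<open>\<lambda>z. hinner H (T z) y\<close> is linear and bounded, so the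
  Riesz theorem supplies a witness for the \<open>THE\<close> in \<open>adjoint_op\<close>.\<close>

lemma
  assumes T: "bounded_op H T" and y: "y \<in> hcarrier H"
  shows adjoint_op_carrier [simp]: "adjoint_op H T y \<in> hcarrier H"
    and inner_adjoint_op:
      "\<And>z. z \<in> hcarrier H \<Longrightarrow> hinner H (T z) y = hinner H z (adjoint_op H T y)"
proof -
  have TH: "T z \<in> hcarrier H" if "z \<in> hcarrier H" for z using T that by (simp add: bounded_op_def)
  obtain C where C: "\<And>z. z \<in> hcarrier H \<Longrightarrow> hnorm H (T z) \<le> C * hnorm H z"
    using T unfolding bounded_op_def by blast
  have "cmod (hinner H (T z) y) \<le> (C * hnorm H y) * hnorm H z" if "z \<in> hcarrier H" for z
    using cauchy_schwarz[OF TH[OF that] y] mult_right_mono[OF C[OF that] hnorm_nonneg[OF y]]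
    by (simp add: ac_simps)
  moreover have "hinner H (T (u + v)) y = hinner H (T u) y + hinner H (T v) y"
    if "u \<in> hcarrier H" "v \<in> hcarrier H" for u v
    using T that y by (simp add: bounded_op_def inner_add_left)
  moreover have "hinner H (T (hscale H c u)) y = c * hinner H (T u) y" if "u \<in> hcarrier H" for c u
    using T that y by (simp add: bounded_op_def inner_scale_left)
  ultimately obtain x
    where x: "x \<in> hcarrier H" "\<And>z. z \<in> hcarrier H \<Longrightarrow> hinner H (T z) y = hinner H z x"
    using riesz_representation[of "\<lambda>z. hinner H (T z) y" "C * hnorm H y"] by blast
  then have "adjoint_op H T y = x" by (rule adjoint_op_eqI)
  with x show "adjoint_op H T y \<in> hcarrier H"
    "\<And>z. z \<in> hcarrier H \<Longrightarrow> hinner H (T z) y = hinner H z (adjoint_op H T y)" by simp_all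
qed

text \<open>A real supremum controls its members only when the set is bounded above; the constant
  from \<open>bounded_op\<close> guarantees this. At \<open>x = 0\<close> both forms of the estimate
  hold because \<open>T 0\<close> has norm \<open>0\<close>.\<close>

lemma contraction_iff:
  "contraction H T \<longleftrightarrow> bounded_op H T \<and> (\<forall>x\<in>hcarrier H. hnorm H (T x) \<le> hnorm H x)"
proof (cases "bounded_op H T")
  case True
  then obtain C where C: "\<And>x. x \<in> hcarrier H \<Longrightarrow> hnorm H (T x) \<le> C * hnorm H x"
    and TH: "\<And>x. x \<in> hcarrier H \<Longrightarrow> T x \<in> hcarrier H"
    unfolding bounded_op_def by blast
  have quot: "hnorm H (T x) / hnorm H x \<le> B \<longleftrightarrow> hnorm H (T x) \<le> B * hnorm H x"
    if "x \<in> hcarrier H" "B \<ge> 0" for x B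
  proof (cases "x = 0")
    case True
    have "hnorm H (T 0) = 0" using C[of 0] hnorm_nonneg[of "T 0"] TH[of 0] by (intro antisym) simp_all
    then show ?thesis using True that by simp
  next
    case False
    then have "hnorm H x > 0" using that hnorm_nonneg[of x] hnorm_eq_0[of x] by linarith
    then show ?thesis by (simp add: field_simps)
  qed
  have "hnorm H (T x) / hnorm H x \<le> max 0 C" if "x \<in> hcarrier H" for x
  proof -
    \<comment> \<open>\<open>C\<close> may be negative when the carrier is trivial.\<close>
    have "C * hnorm H x \<le> max 0 C * hnorm H x" using that by (intro mult_right_mono) simp_all
    then show ?thesis using quot[OF that, of "max 0 C"] C[OF that] by simp
  qed
  then have "bdd_above ((\<lambda>x. hnorm H (T x) / hnorm H x) ` hcarrier H)" by (rule bdd_aboveI2)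
  moreover have "hcarrier H \<noteq> {}" using carrier_zero by blast
  ultimately have "op_norm H T \<le> 1 \<longleftrightarrow> (\<forall>x\<in>hcarrier H. hnorm H (T x) / hnorm H x \<le> 1)"
    unfolding op_norm_def by (intro cSUP_le_iff)
  then show ?thesis using quot[of _ 1] True by (simp add: contraction_def)
qed (simp add: contraction_def)

lemma contractionD:
  assumes "contraction H T" "x \<in> hcarrier H"
  shows "T x \<in> hcarrier H" "hnorm H (T x) \<le> hnorm H x"
    "y \<in> hcarrier H \<Longrightarrow> T (x + y) = T x + T y" "T (hscale H c x) = hscale H c (T x)"
  using assms by (simp_all add: contraction_iff bounded_op_def)

lemma contractionI:
  assumes "\<And>x. x \<in> hcarrier H \<Longrightarrow> T x \<in> hcarrier H"
    and "\<And>x y. \<lbrakk>x \<in> hcarrier H; y \<in> hcarrier H\<rbrakk> \<Longrightarrow> T (x + y) = T x + T y"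
    and "\<And>c x. x \<in> hcarrier H \<Longrightarrow> T (hscale H c x) = hscale H c (T x)"
    and "\<And>x. x \<in> hcarrier H \<Longrightarrow> hnorm H (T x) \<le> hnorm H x"
  shows "contraction H T"
  unfolding contraction_iff bounded_op_def using assms
  by (auto intro!: exI[of _ 1])

lemma contraction_diff:
  assumes "contraction H T" "x \<in> hcarrier H" "y \<in> hcarrier H"
  shows "T (x - y) = T x - T y"
  using contractionD(3)[OF assms(1), of "x - y" y] assms by simp

lemma contraction_funpow: "contraction H T \<Longrightarrow> contraction H (T ^^ n)"
proof (induction n)
  case 0
  show ?case by (rule contractionI) auto
next
  case (Suc n)
  note T = contractionD[OF Suc.prems] and Tn = contractionD[OF Suc.IH[OF Suc.prems]]
  show ?case
    by (rule contractionI) (auto simp: T Tn intro: order_trans[OF T(2) Tn(2)])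
qed

text \<open>With \<open>y\<close> the adjoint applied to \<open>x\<close>, the square of
  \<open>hnorm H y\<close> is the real part of \<open>hinner H (T y) x\<close>, hence at most
  \<open>hnorm H y * hnorm H x\<close>; one factor cancels.\<close>

lemma contraction_adjoint_op:
  assumes "contraction H T"
  shows "contraction H (adjoint_op H T)"
proof (rule contractionI)
  have T: "bounded_op H T" using assms by (simp add: contraction_def)
  note TH = contractionD(1)[OF assms]
  show carrier: "adjoint_op H T x \<in> hcarrier H" if "x \<in> hcarrier H" for x
    using T that by simp
  show "adjoint_op H T (x + y) = adjoint_op H T x + adjoint_op H T y"
    if "x \<in> hcarrier H" "y \<in> hcarrier H" for x y
    using that by (intro adjoint_op_eqI) (auto simp: carrier inner_add_right TH inner_adjoint_op[OF T])
  show "adjoint_op H T (hscale H c x) = hscale H c (adjoint_op H T x)" if "x \<in> hcarrier H" for c x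
    using that by (intro adjoint_op_eqI) (auto simp: carrier inner_scale_right TH inner_adjoint_op[OF T])
  show "hnorm H (adjoint_op H T x) \<le> hnorm H x" if x: "x \<in> hcarrier H" for x
  proof -
    let ?y = "adjoint_op H T x"
    have y: "?y \<in> hcarrier H" using carrier x .
    have "(hnorm H ?y)\<^sup>2 = Re (hinner H (T ?y) x)"
      using inner_adjoint_op[OF T x y] y by (simp add: power2_hnorm)
    also have "\<dots> \<le> hnorm H (T ?y) * hnorm H x"
      using cauchy_schwarz[OF TH[OF y] x] complex_Re_le_cmod order_trans by blast
    also have "\<dots> \<le> hnorm H ?y * hnorm H x"
      using contractionD(2)[OF assms y] x by (intro mult_right_mono) auto
    finally show ?thesis
      using y x hnorm_nonneg[OF y] hnorm_nonneg[OF x]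
      by (cases "hnorm H ?y = 0") (auto simp: power2_eq_square)
  qed
qed

section \<open>The defect form and strong limits of powers\<close>

text \<open>Applying the contraction bound to \<open>f - hscale H c g\<close> and expanding both
  sides shows that the defect form is positive semidefinite.\<close>

lemma contraction_defect_cauchy_schwarz:
  assumes T: "contraction H T" and f: "f \<in> hcarrier H" and g: "g \<in> hcarrier H"
  shows "(cmod (hinner H f g - hinner H (T f) (T g)))\<^sup>2 \<le>
    ((hnorm H f)\<^sup>2 - (hnorm H (T f))\<^sup>2) * ((hnorm H g)\<^sup>2 - (hnorm H (T g))\<^sup>2)"
proof (rule complex_quadratic_nonneg_imp)
  note TD = contractionD[OF T]
  show "0 \<le> (hnorm H g)\<^sup>2 - (hnorm H (T g))\<^sup>2"
    using power_mono[OF TD(2)[OF g], of 2] TD(1)[OF g] by simp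
  fix c
  have "hnorm H (T f - hscale H c (T g)) \<le> hnorm H (f - hscale H c g)"
    using TD(2)[of "f - hscale H c g"] contraction_diff[OF T, of f "hscale H c g"] f g
    by (simp add: TD(4))
  then have "(hnorm H (T f - hscale H c (T g)))\<^sup>2 \<le> (hnorm H (f - hscale H c g))\<^sup>2"
    by (rule power_mono) (simp add: TD(1) f g)
  then show "0 \<le> (hnorm H f)\<^sup>2 - (hnorm H (T f))\<^sup>2
      - 2 * Re (cnj c * (hinner H f g - hinner H (T f) (T g)))
      + (cmod c)\<^sup>2 * ((hnorm H g)\<^sup>2 - (hnorm H (T g))\<^sup>2)"
    using f g by (simp add: power2_hnorm_diff_scale TD(1) algebra_simps)
qed

text \<open>The defect inequality for \<open>T ^^ n\<close> passes to the limit: the mixed term is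
  bounded by a product of norms whose first factor tends to \<open>0\<close>.\<close>

lemma inner_bound_of_strong_limit_zero:
  assumes T: "contraction H T" and f: "f \<in> hcarrier H" and g: "g \<in> hcarrier H"
    and f0: "(\<lambda>n. hnorm H ((T ^^ n) f)) \<longlonglongrightarrow> 0"
    and L: "(\<lambda>n. hnorm H ((T ^^ n) g)) \<longlonglongrightarrow> L"
  shows "(cmod (hinner H f g))\<^sup>2 \<le> (hnorm H f)\<^sup>2 * ((hnorm H g)\<^sup>2 - L\<^sup>2)"
proof (rule LIMSEQ_le)
  note TD = contractionD[OF contraction_funpow[OF T]]
  have "(\<lambda>n. hinner H ((T ^^ n) f) ((T ^^ n) g)) \<longlonglongrightarrow> 0"
  proof (rule Lim_null_comparison)
    show "(\<lambda>n. hnorm H ((T ^^ n) f) * hnorm H ((T ^^ n) g)) \<longlonglongrightarrow> 0"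
      using tendsto_mult[OF f0 L] by simp
  qed (simp add: cauchy_schwarz TD(1) f g)
  then show "(\<lambda>n. (cmod (hinner H f g - hinner H ((T ^^ n) f) ((T ^^ n) g)))\<^sup>2)
      \<longlonglongrightarrow> (cmod (hinner H f g))\<^sup>2"
    by (auto intro!: tendsto_eq_intros)
  show "(\<lambda>n. ((hnorm H f)\<^sup>2 - (hnorm H ((T ^^ n) f))\<^sup>2) * ((hnorm H g)\<^sup>2 - (hnorm H ((T ^^ n) g))\<^sup>2))
      \<longlonglongrightarrow> (hnorm H f)\<^sup>2 * ((hnorm H g)\<^sup>2 - L\<^sup>2)"
    by (auto intro!: tendsto_eq_intros f0 L)
qed (auto intro: contraction_defect_cauchy_schwarz contraction_funpow T f g)

lemma hnorm_funpow_contraction_convergent: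
  assumes T: "contraction H T" and x: "x \<in> hcarrier H"
  shows "convergent (\<lambda>n. hnorm H ((T ^^ n) x))"
proof -
  note TD = contractionD[OF contraction_funpow[OF T] x]
  have "decseq (\<lambda>n. hnorm H ((T ^^ n) x))"
    by (rule decseq_SucI) (simp add: contractionD[OF T] TD)
  moreover have "\<forall>n. 0 \<le> hnorm H ((T ^^ n) x)" using TD(1) by simp
  ultimately show ?thesis
    using decseq_convergent unfolding convergent_def by blast
qed

text \<open>Powers of a contraction are uniformly bounded, so the vectors sent to \<open>0\<close>
  form a closed subspace \<open>S\<close>. It contains \<open>K\<close>, and the residual of
  \<open>f\<close> after projection to \<open>S\<close> is orthogonal to \<open>K\<close>, hence
  zero.\<close>

lemma strong_limit_zero_of_total:
  assumes T: "contraction H T" and K: "K \<subseteq> hcarrier H"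
    and total: "\<And>f. \<lbrakk>f \<in> hcarrier H; \<And>g. g \<in> K \<Longrightarrow> hinner H f g = 0\<rbrakk> \<Longrightarrow> f = 0"
    and lim: "\<And>g. g \<in> K \<Longrightarrow> (\<lambda>n. hnorm H ((T ^^ n) g)) \<longlonglongrightarrow> 0"
    and f: "f \<in> hcarrier H"
  shows "(\<lambda>n. hnorm H ((T ^^ n) f)) \<longlonglongrightarrow> 0"
proof -
  note TD = contractionD[OF contraction_funpow[OF T]]
  define S where "S = {f \<in> hcarrier H. (\<lambda>n. hnorm H ((T ^^ n) f)) \<longlonglongrightarrow> 0}"
  have SH: "S \<subseteq> hcarrier H" by (auto simp: S_def)
  have subspace: "subspace S"
    unfolding subspace_def
  proof (intro conjI ballI allI)
    have "(T ^^ n) 0 = 0" for n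
      using TD(4)[of 0 n 0] by simp
    then show "0 \<in> S" by (simp add: S_def)
    show "x + y \<in> S" if "x \<in> S" "y \<in> S" for x y
    proof -
      have "(\<lambda>n. hnorm H ((T ^^ n) (x + y))) \<longlonglongrightarrow> 0"
      proof (rule Lim_null_comparison)
        show "(\<lambda>n. hnorm H ((T ^^ n) x) + hnorm H ((T ^^ n) y)) \<longlonglongrightarrow> 0"
          using that by (auto simp: S_def intro: tendsto_add_zero)
      qed (use that in \<open>auto intro!: always_eventually hnorm_triangle simp: S_def TD\<close>)
      then show ?thesis using that by (simp add: S_def)
    qed
    show "hscale H c x \<in> S" if "x \<in> S" for c x
      using that by (auto simp: S_def TD hnorm_scale intro: tendsto_mult_right_zero)
  qed
  have closed: "g \<in> S"
    if X: "\<And>n. X n \<in> S" and g: "g \<in> hcarrier H" "(\<lambda>n. hnorm H (X n - g)) \<longlonglongrightarrow> 0" for X g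
  proof -
    have "(\<lambda>n. hnorm H ((T ^^ n) g)) \<longlonglongrightarrow> 0"
    proof (rule LIMSEQ_I)
      fix e :: real assume "e > 0"
      have XH: "X n \<in> hcarrier H" for n using X by (simp add: S_def)
      obtain m where m: "hnorm H (X m - g) < e / 2"
        using LIMSEQ_D[OF g(2), of "e / 2"] \<open>e > 0\<close> XH g(1) by auto
      obtain N where N: "\<And>n. n \<ge> N \<Longrightarrow> hnorm H ((T ^^ n) (X m)) < e / 2"
        using X[of m] LIMSEQ_D[of "\<lambda>n. hnorm H ((T ^^ n) (X m))" 0 "e / 2"] \<open>e > 0\<close> XH
        by (auto simp: S_def TD)
      have "hnorm H ((T ^^ n) g) < e" if "n \<ge> N" for n
      proof -
        have "hnorm H ((T ^^ n) g) \<le> hnorm H ((T ^^ n) (g - X m)) + hnorm H ((T ^^ n) (X m))"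
          using hnorm_triangle[of "(T ^^ n) (g - X m)" "(T ^^ n) (X m)"]
            TD(3)[of "g - X m" "X m" n] g(1) XH by (simp add: TD(1))
        also have "\<dots> \<le> hnorm H (g - X m) + hnorm H ((T ^^ n) (X m))"
          using TD(2)[of "g - X m" n] g(1) XH by simp
        finally show ?thesis
          using m N[OF that] hnorm_minus_commute[of g "X m"] g(1) XH by simp
      qed
      then show "\<exists>N. \<forall>n\<ge>N. norm (hnorm H ((T ^^ n) g) - 0) < e"
        using g(1) by (auto simp: TD)
    qed
    then show ?thesis using g by (simp add: S_def)
  qed
  obtain p where p: "p \<in> S" "\<And>s. s \<in> S \<Longrightarrow> hinner H (f - p) s = 0"
    by (rule orthogonal_projection[OF subspace SH _ f], rule closed) auto
  have "K \<subseteq> S" using K lim by (auto simp: S_def)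
  then have "f - p = 0"
    using p SH f by (intro total) auto
  then show ?thesis using p(1) by (simp add: S_def)
qed

end


section \<open>Contractive multipliers\<close>

locale contractive_multiplier = E: complex_hilbert_space E
  for E :: "'e::ab_group_add hspace" +
  fixes \<Lambda> :: "'x set" and k :: "'x \<Rightarrow> 'x \<Rightarrow> complex"
    and H :: "('x \<Rightarrow> 'e) hspace" and \<Phi> :: "'x \<Rightarrow> 'e \<Rightarrow> 'e"
  assumes rkhs: "is_rkhs \<Lambda> E (scalar_kernel E k) H"
    and Mult1: "\<Phi> \<in> Mult1 \<Lambda> E H"
begin

sublocale H: complex_hilbert_space H
  using rkhs by (simp add: is_rkhs_def)

text \<open>The extension by \<open>0\<close> reproduces literally the function occurring in
  \<open>is_rkhs\<close>, with \<open>scalar_kernel\<close> unfolded.\<close>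

definition kernel_fun :: "'x \<Rightarrow> 'e \<Rightarrow> 'x \<Rightarrow> 'e" where
  "kernel_fun w e = (\<lambda>z. if z \<in> \<Lambda> then hscale E (k z w) e else 0)"

abbreviation adj_mult :: "('x \<Rightarrow> 'e) \<Rightarrow> 'x \<Rightarrow> 'e" where
  "adj_mult \<equiv> adjoint_op H (mult_op \<Lambda> \<Phi>)"

abbreviation adj_val :: "'x \<Rightarrow> 'e \<Rightarrow> 'e" where
  "adj_val w \<equiv> adjoint_op E (\<Phi> w)"

lemma kernel_fun_carrier [simp]:
  "\<lbrakk>w \<in> \<Lambda>; e \<in> hcarrier E\<rbrakk> \<Longrightarrow> kernel_fun w e \<in> hcarrier H"
  using rkhs unfolding is_rkhs_def scalar_kernel_def kernel_fun_def by blast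

lemma inner_kernel_fun:
  "\<lbrakk>w \<in> \<Lambda>; e \<in> hcarrier E; f \<in> hcarrier H\<rbrakk> \<Longrightarrow> hinner H f (kernel_fun w e) = hinner E (f w) e"
  using rkhs unfolding is_rkhs_def scalar_kernel_def kernel_fun_def by blast

lemma value_carrier: "\<lbrakk>f \<in> hcarrier H; w \<in> \<Lambda>\<rbrakk> \<Longrightarrow> f w \<in> hcarrier E"
  using rkhs by (simp add: is_rkhs_def)

lemma power2_hnorm_kernel_fun:
  assumes "w \<in> \<Lambda>" "e \<in> hcarrier E"
  shows "(hnorm H (kernel_fun w e))\<^sup>2 = Re (k w w) * (hnorm E e)\<^sup>2"
  using assms
  by (simp add: H.power2_hnorm inner_kernel_fun)
    (simp add: kernel_fun_def E.inner_scale_left E.inner_self)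

text \<open>Testing against \<open>e = f w\<close> makes the norm of \<open>f w\<close> vanish;
  outside \<open>\<Lambda>\<close> the function is \<open>0\<close> by convention.\<close>

lemma kernel_fun_total:
  assumes f: "f \<in> hcarrier H"
    and orth: "\<And>w e. \<lbrakk>w \<in> \<Lambda>; e \<in> hcarrier E\<rbrakk> \<Longrightarrow> hinner H f (kernel_fun w e) = 0"
  shows "f = 0"
proof
  fix w
  show "f w = 0 w"
  proof (cases "w \<in> \<Lambda>")
    case True
    then have "f w \<in> hcarrier E" using value_carrier[OF f] by simp
    then show ?thesis
      using orth[OF True, of "f w"] inner_kernel_fun[OF True _ f, of "f w"] E.inner_definite by simp
  next
    case False
    then show ?thesis using rkhs f by (simp add: is_rkhs_def)
  qed
qed

lemma contraction_mult_op: "contraction H (mult_op \<Lambda> \<Phi>)"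
  using Mult1 by (simp add: Mult1_def contraction_def)

lemmas contraction_adj_mult = H.contraction_adjoint_op[OF contraction_mult_op]

lemma bounded_op_value: "w \<in> \<Lambda> \<Longrightarrow> bounded_op E (\<Phi> w)"
  using Mult1 by (simp add: Mult1_def multiplier_def)

lemma adj_val_carrier [simp]: "\<lbrakk>w \<in> \<Lambda>; e \<in> hcarrier E\<rbrakk> \<Longrightarrow> adj_val w e \<in> hcarrier E"
  using bounded_op_value by simp

text \<open>Paired with any \<open>f\<close>, both sides give
  \<open>hinner E (\<Phi> w (f w)) e\<close> by the reproducing property.\<close>

lemma adj_mult_kernel_fun:
  assumes w: "w \<in> \<Lambda>" and e: "e \<in> hcarrier E"
  shows "adj_mult (kernel_fun w e) = kernel_fun w (adj_val w e)"
proof (rule H.adjoint_op_eqI)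
  fix f assume f: "f \<in> hcarrier H"
  have "hinner H (mult_op \<Lambda> \<Phi> f) (kernel_fun w e) = hinner E (\<Phi> w (f w)) e"
    using inner_kernel_fun[OF w e] H.contractionD(1)[OF contraction_mult_op f] w
    by (simp add: mult_op_def)
  also have "\<dots> = hinner E (f w) (adj_val w e)"
    using E.inner_adjoint_op[OF bounded_op_value[OF w] e] value_carrier[OF f w] .
  finally show "hinner H (mult_op \<Lambda> \<Phi> f) (kernel_fun w e) = hinner H f (kernel_fun w (adj_val w e))"
    using inner_kernel_fun[OF w _ f] w e by simp
qed (use assms in simp)

lemma funpow_adj_val_carrier [simp]:
  "\<lbrakk>w \<in> \<Lambda>; e \<in> hcarrier E\<rbrakk> \<Longrightarrow> (adj_val w ^^ n) e \<in> hcarrier E"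
  by (induction n) auto

lemma funpow_adj_mult_kernel_fun:
  assumes "w \<in> \<Lambda>" "e \<in> hcarrier E"
  shows "(adj_mult ^^ n) (kernel_fun w e) = kernel_fun w ((adj_val w ^^ n) e)"
  by (induction n) (use assms in \<open>auto simp: adj_mult_kernel_fun\<close>)

end

section \<open>Kernels normalized at a base point\<close>

locale normalized_contractive_multiplier = contractive_multiplier E \<Lambda> k H \<Phi>
  for E :: "'e::ab_group_add hspace" and \<Lambda> :: "'x set" and k H \<Phi> +
  fixes z0 :: 'x
  assumes base: "z0 \<in> \<Lambda>" and normalized: "\<And>z. z \<in> \<Lambda> \<Longrightarrow> k z z0 = 1"
begin

text \<open>By normalization \<open>kernel_fun z0 e\<close> is constantly \<open>e\<close> on
  \<open>\<Lambda>\<close>, which embeds \<open>E\<close> isometrically in \<open>H\<close>.\<close>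

lemma hnorm_kernel_fun_base:
  assumes "e \<in> hcarrier E"
  shows "hnorm H (kernel_fun z0 e) = hnorm E e"
  using power2_hnorm_kernel_fun[OF base assms] base assms
  by - (rule power2_eq_imp_eq, auto simp: normalized)

text \<open>Along the isometric embedding of \<open>E\<close>, the adjoint of
  \<open>\<Phi> z0\<close> is a restriction of the contraction \<open>adj_mult\<close>. Pairing
  \<open>\<Phi> z0 x\<close> with itself moves the bound back to \<open>\<Phi> z0\<close>.\<close>

lemma contraction_value_base: "contraction E (\<Phi> z0)"
  unfolding E.contraction_iff
proof (intro conjI ballI)
  show T: "bounded_op E (\<Phi> z0)" using bounded_op_value[OF base] .
  fix x assume x: "x \<in> hcarrier E"
  let ?y = "\<Phi> z0 x"
  have y: "?y \<in> hcarrier E" using T x by (simp add: bounded_op_def)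
  have "hnorm E (adj_val z0 ?y) = hnorm H (adj_mult (kernel_fun z0 ?y))"
    using y base by (simp add: adj_mult_kernel_fun hnorm_kernel_fun_base)
  also have "\<dots> \<le> hnorm E ?y"
    using H.contractionD(2)[OF contraction_adj_mult, of "kernel_fun z0 ?y"] y base
    by (simp add: hnorm_kernel_fun_base)
  finally have adj: "hnorm E (adj_val z0 ?y) \<le> hnorm E ?y" .
  have "(hnorm E ?y)\<^sup>2 = Re (hinner E x (adj_val z0 ?y))"
    using E.inner_adjoint_op[OF T y x] y by (simp add: E.power2_hnorm)
  also have "\<dots> \<le> hnorm E x * hnorm E (adj_val z0 ?y)"
    using E.cauchy_schwarz[of x "adj_val z0 ?y"] x y base complex_Re_le_cmod order_trans
    by (meson adj_val_carrier)
  also have "\<dots> \<le> hnorm E x * hnorm E ?y"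
    using adj x by (intro mult_left_mono) auto
  finally show "hnorm E ?y \<le> hnorm E x"
    using y x E.hnorm_nonneg[OF y] E.hnorm_nonneg[OF x]
    by (cases "hnorm E ?y = 0") (auto simp: power2_eq_square)
qed

lemma strong_limit_zero_kernel_fun:
  assumes pure: "\<And>e. e \<in> hcarrier E \<Longrightarrow> (\<lambda>n. hnorm E ((adj_val z0 ^^ n) e)) \<longlonglongrightarrow> 0"
    and w: "w \<in> \<Lambda>" and e: "e \<in> hcarrier E"
  shows "(\<lambda>n. hnorm H ((adj_mult ^^ n) (kernel_fun w e))) \<longlonglongrightarrow> 0"
proof -
  define c where "c = Re (k w w)"
  define y where "y n = (adj_val w ^^ n) e" for n
  have y: "y n \<in> hcarrier E" for n using w e by (simp add: y_def)
  define s where "s n = (hnorm H (kernel_fun w (y n)))\<^sup>2" for n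
  have s_eq: "s n = c * (hnorm E (y n))\<^sup>2" for n
    using power2_hnorm_kernel_fun[OF w y] by (simp add: s_def c_def)
  have power: "(adj_mult ^^ n) (kernel_fun w e) = kernel_fun w (y n)" for n
    using funpow_adj_mult_kernel_fun[OF w e] by (simp add: y_def)
  \<comment> \<open>Here \<open>L\<close> is the limit of the norms in \<open>H\<close>, not in
    \<open>E\<close> as in the outline above, so \<open>L\<^sup>2\<close> absorbs the factor
    \<open>c\<close>.\<close>
  obtain L where L: "(\<lambda>n. hnorm H (kernel_fun w (y n))) \<longlonglongrightarrow> L"
    using H.hnorm_funpow_contraction_convergent[OF contraction_adj_mult kernel_fun_carrier[OF w e]]
    unfolding power convergent_def by blast
  have bound: "(hnorm E (y m))\<^sup>2 \<le> s m - L\<^sup>2" for m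
  proof -
    \<comment> \<open>Starting at \<open>y m\<close> only drops an initial segment, so the limit
      \<open>L\<close> is the same for every \<open>m\<close>.\<close>
    have shifted: "(adj_mult ^^ n) (kernel_fun w (y m)) = kernel_fun w (y (n + m))" for n
      using power[of m] power[of "n + m"] by (simp add: funpow_add)
    have "(cmod (hinner H (kernel_fun z0 (y m)) (kernel_fun w (y m))))\<^sup>2
        \<le> (hnorm H (kernel_fun z0 (y m)))\<^sup>2 * (s m - L\<^sup>2)"
      unfolding s_def
    proof (rule H.inner_bound_of_strong_limit_zero[OF contraction_adj_mult])
      show "(\<lambda>n. hnorm H ((adj_mult ^^ n) (kernel_fun z0 (y m)))) \<longlonglongrightarrow> 0"
        using pure[OF y[of m]] y base by (simp add: funpow_adj_mult_kernel_fun hnorm_kernel_fun_base)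
      show "(\<lambda>n. hnorm H ((adj_mult ^^ n) (kernel_fun w (y m)))) \<longlonglongrightarrow> L"
        unfolding shifted using L by (rule LIMSEQ_ignore_initial_segment)
    qed (use y base w in auto)
    moreover have "hinner H (kernel_fun z0 (y m)) (kernel_fun w (y m)) = of_real ((hnorm E (y m))\<^sup>2)"
      \<comment> \<open>The reproducing property at \<open>w\<close> is applied while the kernel
        functions are folded; then \<open>k w z0 = 1\<close> leaves the pairing of
        \<open>y m\<close> with itself.\<close>
      using w y base by (simp only: inner_kernel_fun kernel_fun_carrier)
        (simp add: kernel_fun_def normalized E.inner_self)
    ultimately have "(hnorm E (y m))\<^sup>2 * (hnorm E (y m))\<^sup>2 \<le> (hnorm E (y m))\<^sup>2 * (s m - L\<^sup>2)"
      using y by (simp add: hnorm_kernel_fun_base norm_mult power2_eq_square)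
    \<comment> \<open>The factor \<open>(hnorm E (y m))\<^sup>2\<close> cannot be cancelled when it
      is \<open>0\<close>; the bound is then this inequality, which follows from
      monotonicity.\<close>
    moreover have "0 \<le> s m - L\<^sup>2"
    proof -
      have "decseq (\<lambda>n. hnorm H (kernel_fun w (y n)))"
      proof (rule decseq_SucI)
        fix n
        have "kernel_fun w (y (Suc n)) = adj_mult (kernel_fun w (y n))"
          using adj_mult_kernel_fun[OF w y] by (simp add: y_def)
        then show "hnorm H (kernel_fun w (y (Suc n))) \<le> hnorm H (kernel_fun w (y n))"
          using H.contractionD(2)[OF contraction_adj_mult kernel_fun_carrier[OF w y]] by simp
      qed
      then have "L \<le> hnorm H (kernel_fun w (y m))" using L by (rule decseq_ge)
      moreover have "0 \<le> L" using L by (rule LIMSEQ_le_const) (use y w in auto)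
      ultimately show ?thesis by (simp add: s_def power_mono)
    qed
    ultimately show ?thesis
      by (cases "hnorm E (y m) = 0") (simp, metis mult_le_cancel_left_pos zero_less_power2)
  qed
  have s_lim: "s \<longlonglongrightarrow> L\<^sup>2" unfolding s_def by (intro tendsto_intros L)
  \<comment> \<open>The bound squeezes these norms to \<open>0\<close>, so \<open>s\<close> tends to
    \<open>0\<close> by \<open>s_eq\<close>; comparison with \<open>s_lim\<close> yields
    \<open>L = 0\<close>.\<close>
  have "(\<lambda>n. (hnorm E (y n))\<^sup>2) \<longlonglongrightarrow> 0"
  proof (rule Lim_null_comparison)
    show "(\<lambda>n. s n - L\<^sup>2) \<longlonglongrightarrow> 0" using tendsto_diff[OF s_lim tendsto_const[of "L\<^sup>2"]] by simp
  qed (use bound in auto)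
  then have "s \<longlonglongrightarrow> 0" unfolding s_eq by (rule tendsto_mult_right_zero)
  then have "L\<^sup>2 = 0" by (rule LIMSEQ_unique[OF s_lim])
  then have "L = 0" by simp
  then show ?thesis using L by (simp add: power)
qed

text \<open>Contractivity comes from \<open>contraction_value_base\<close> in one direction and from
  membership in \<open>Mult1\<close> in the other; the limits pass through the embedding of
  \<open>E\<close> and through totality of the kernel functions.\<close>

lemma pure_contraction_mult_op_iff:
  "pure_contraction H (mult_op \<Lambda> \<Phi>) \<longleftrightarrow> pure_contraction E (\<Phi> z0)"
proof
  assume "pure_contraction H (mult_op \<Lambda> \<Phi>)"
  then have "(\<lambda>n. hnorm H ((adj_mult ^^ n) (kernel_fun z0 e))) \<longlonglongrightarrow> 0" if "e \<in> hcarrier E" for e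
    using that base by (simp add: pure_contraction_def)
  then show "pure_contraction E (\<Phi> z0)"
    using base contraction_value_base
    by (simp add: pure_contraction_def funpow_adj_mult_kernel_fun hnorm_kernel_fun_base)
next
  assume "pure_contraction E (\<Phi> z0)"
  then have lim: "(\<lambda>n. hnorm H ((adj_mult ^^ n) (kernel_fun w e))) \<longlonglongrightarrow> 0"
    if "w \<in> \<Lambda>" "e \<in> hcarrier E" for w e
    using that strong_limit_zero_kernel_fun by (simp add: pure_contraction_def)
  have "(\<lambda>n. hnorm H ((adj_mult ^^ n) f)) \<longlonglongrightarrow> 0" if "f \<in> hcarrier H" for f
    by (rule H.strong_limit_zero_of_total[OF contraction_adj_mult,
        of "{kernel_fun w e | w e. w \<in> \<Lambda> \<and> e \<in> hcarrier E}"])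
      (use that lim in \<open>auto intro: kernel_fun_total\<close>)
  then show "pure_contraction H (mult_op \<Lambda> \<Phi>)"
    using contraction_mult_op by (simp add: pure_contraction_def)
qed

end

section \<open>Specialization to the unit ball\<close>

text \<open>At \<open>w = 0\<close> the power series is evaluated at \<open>0\<close>, and since
  \<open>0 ^ 0 = 1\<close> only the term \<open>a 0 = 1\<close> survives.\<close>

lemma unitarily_invariant_kernel_zero_right:
  assumes "unitarily_invariant_kernel k" "z \<in> ball 0 1"
  shows "k z 0 = 1"
proof -
  obtain a :: "nat \<Rightarrow> real" where a: "a 0 = 1"
    "(\<lambda>j. of_real (a j) * cinner z 0 ^ j) sums k z 0"
    using assms by (auto simp: unitarily_invariant_kernel_def)
  have "cinner z 0 = 0" by (simp add: cinner_def)
  then have "k z 0 = of_real (a 0)"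
    using a(2) sums_unique2[OF _ powser_sums_zero[of "\<lambda>j. of_real (a j)"]] by simp
  then show ?thesis by (simp add: a(1))
qed

theorem theorem4p6:
  fixes E :: "'e::ab_group_add hspace"
    and k :: "complex^'n \<Rightarrow> complex^'n \<Rightarrow> complex"
    and H :: "(complex^'n \<Rightarrow> 'e) hspace"
    and \<Phi> :: "complex^'n \<Rightarrow> 'e \<Rightarrow> 'e"
  assumes "complex_hilbert_space E"
    and "unitarily_invariant_CNP_space E k H"
    and "\<Phi> \<in> Mult1 (ball 0 1) E H"
  shows "pure_contraction H (mult_op (ball 0 1) \<Phi>) \<longleftrightarrow> pure_contraction E (\<Phi> 0)"
proof -
  interpret E: complex_hilbert_space E by fact
  interpret normalized_contractive_multiplier E "ball 0 1" k H \<Phi> 0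
    using assms(2,3)
    by unfold_locales
      (auto simp: unitarily_invariant_CNP_space_def unitarily_invariant_kernel_zero_right)
  show ?thesis by (rule pure_contraction_mult_op_iff)
qed

end
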